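(* Let $\bar v,\bar q,\bar\kappa,\bar\mu>0$ be constants, $\beta(\xi):=\bar q+\xi^2\bar\kappa$, and $$\widetilde A(\xi):=\begin{pmatrix}0&-\beta(\xi)^{1/2}\\-\beta(\xi)^{1/2}&0\end{pmatrix},\qquad \widetilde B(\xi):=\xi^2\begin{pmatrix}0&0\\0&\bar\mu/\bar v\end{pmatrix},\qquad \xi\in\mathbb R.$$ There exist uniform constants $C,k>0$ such that every solution $\hat V=\hat V(\xi,t)\in\mathbb C^2$ of the system $$\hat V_t+i\xi\widetilde A(\xi)\hat V+\widetilde B(\xi)\hat V=0$$ satisfies $$|\hat V(\xi,t)|\le C\,|\hat V(\xi,0)|\exp\Big(-\frac{k\xi^2t}{1+\xi^2}\Big)\qquad\text{for all }\xi\in\mathbb R,\ t\ge0.$$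
   Context: The system is the Fourier-transformed linearized isothermal Navier–Stokes–Korteweg system, written in symmetrized variables, with $\xi\in\mathbb R$ the Fourier variable (a parameter in the equation) and $t\ge0$ time. "Uniform" means that $C$ and $k$ do not depend on $\xi$, $t$ or the solution (they may depend on $\bar v,\bar q,\bar\kappa,\bar\mu$). *)

theory Defs
  imports "HOL-Analysis.Analysis"
begin

definition beta :: "real \<Rightarrow> real \<Rightarrow> real \<Rightarrow> real" where
  "beta q \<kappa> \<xi> = q + \<xi>\<^sup>2 * \<kappa>"

definition A_tilde :: "real \<Rightarrow> real \<Rightarrow> real \<Rightarrow> complex^2^2" where
  "A_tilde q \<kappa> \<xi> =
     vector [vector [0, - complex_of_real (sqrt (beta q \<kappa> \<xi>))],
             vector [- complex_of_real (sqrt (beta q \<kappa> \<xi>)), 0]]"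

definition B_tilde :: "real \<Rightarrow> real \<Rightarrow> real \<Rightarrow> complex^2^2" where
  "B_tilde v \<mu> \<xi> =
     \<xi>\<^sup>2 *\<^sub>R vector [vector [0, 0], vector [0, complex_of_real (\<mu> / v)]]"

text \<open>
  Classical solutions on the half line of times \<open>t \<ge> 0\<close>, for every frequency \<open>\<xi>\<close>.
  The time derivative is taken within \<open>{0..}\<close>, hence is one-sided at \<open>t = 0\<close>; no regularity
  in \<open>\<xi>\<close> is required, since \<open>\<xi>\<close> is only a parameter.
\<close>

definition is_solution ::
    "real \<Rightarrow> real \<Rightarrow> real \<Rightarrow> real \<Rightarrow> (real \<Rightarrow> real \<Rightarrow> complex^2) \<Rightarrow> bool" where
  "is_solution v q \<kappa> \<mu> V \<longleftrightarrow>
     (\<forall>\<xi>. \<forall>t\<ge>0. \<exists>V\<^sub>t.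
        (V \<xi> has_vector_derivative V\<^sub>t) (at t within {0..}) \<and>
        V\<^sub>t + (\<i> * complex_of_real \<xi>) *s (A_tilde q \<kappa> \<xi> *v V \<xi> t)
           + B_tilde v \<mu> \<xi> *v V \<xi> t = 0)"

end

(*
  Writing V = (a, b), m = mu / v and s = sqrt (beta), the energy |a|^2 + |b|^2 only dissipates b:
  its derivative is -2 m xi^2 |b|^2.  The cross term X = Im (cnj a * b) satisfies
  X' = xi s (|a|^2 - |b|^2) - m xi^2 X, so that |a|^2 + |b|^2 - 2 d (xi / s) X dissipates a as well.
  Since |xi / s| <= 1 / sqrt kappa, for small d, chosen independently of xi, this perturbed energy
  is equivalent to |a|^2 + |b|^2 and decays at the rate (2/3) d xi^2, which is at least
  (2/3) d xi^2 / (1 + xi^2).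
*)
theory Submission
  imports Defs
begin

text \<open>Gronwall's lemma in differential form: the integrating factor \<open>exp (r * t)\<close>
  turns the inequality into monotonicity of \<open>exp (r * t) * E t\<close>.\<close>

lemma exponential_decay_of_differential_inequality:
  fixes E :: "real \<Rightarrow> real"
  assumes deriv: "\<And>t. t \<ge> 0 \<Longrightarrow> (E has_real_derivative E' t) (at t within {0..})"
    and decay: "\<And>t. t \<ge> 0 \<Longrightarrow> E' t \<le> - r * E t"
    and "t \<ge> 0"
  shows "E t \<le> E 0 * exp (- r * t)"
proof -
  let ?F = "\<lambda>t. exp (r * t) * E t"
  have F: "(?F has_real_derivative exp (r * x) * (r * E x + E' x)) (at x within {0..})"
    if "x \<ge> 0" for x
    by (auto intro!: derivative_eq_intros deriv[OF that] simp: algebra_simps)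
  have "?F t \<le> ?F 0"
  proof (rule DERIV_nonpos_imp_decreasing_open[OF \<open>t \<ge> 0\<close>])
    fix x :: real assume x: "0 < x" "x < t"
    \<comment> \<open>The monotonicity criterion asks for two-sided derivatives on the open interval
      only; at 0 the one-sided derivative enters through continuity.\<close>
    then have "at x within {0..} = at x"
      by (intro at_within_interior) auto
    with F[of x] x have "(?F has_real_derivative exp (r * x) * (r * E x + E' x)) (at x)"
      by simp
    moreover have "exp (r * x) * (r * E x + E' x) \<le> 0"
      using decay[of x] x by (intro mult_nonneg_nonpos) auto
    ultimately show "\<exists>y. (?F has_real_derivative y) (at x) \<and> y \<le> 0" by blast
  next
    have "continuous_on {0..} ?F"
      using F by (intro DERIV_continuous_on) auto
    then show "continuous_on {0..t} ?F"
      by (rule continuous_on_subset) auto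
  qed
  then show ?thesis
    by (simp add: exp_minus field_simps)
qed

lemma is_solution_components:
  assumes "is_solution v q \<kappa> \<mu> V" and "t \<ge> 0"
  defines "s \<equiv> \<lambda>\<xi>. sqrt (beta q \<kappa> \<xi>)"
  shows "((\<lambda>t. V \<xi> t $ 1) has_vector_derivative \<i> * of_real (\<xi> * s \<xi>) * V \<xi> t $ 2)
           (at t within {0..})"
    and "((\<lambda>t. V \<xi> t $ 2) has_vector_derivative
           \<i> * of_real (\<xi> * s \<xi>) * V \<xi> t $ 1 - of_real (\<mu> / v * \<xi>\<^sup>2) * V \<xi> t $ 2)
           (at t within {0..})"
proof -
  obtain W where W: "(V \<xi> has_vector_derivative W) (at t within {0..})"
    and eq: "W + (\<i> * complex_of_real \<xi>) *s (A_tilde q \<kappa> \<xi> *v V \<xi> t)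
      + B_tilde v \<mu> \<xi> *v V \<xi> t = 0"
    using assms unfolding is_solution_def by blast
  have comp: "((\<lambda>t. V \<xi> t $ i) has_vector_derivative W $ i) (at t within {0..})" for i
    using bounded_linear.has_vector_derivative[OF bounded_linear_vec_nth W] .
  have "W $ 1 = \<i> * of_real (\<xi> * s \<xi>) * V \<xi> t $ 2"
    using arg_cong[OF eq, of "\<lambda>x. x $ 1"]
    by (simp add: A_tilde_def B_tilde_def matrix_vector_mult_def sum_2 s_def algebra_simps)
  with comp[of 1] show "((\<lambda>t. V \<xi> t $ 1) has_vector_derivative
      \<i> * of_real (\<xi> * s \<xi>) * V \<xi> t $ 2) (at t within {0..})" by simp
  have "W $ 2 = \<i> * of_real (\<xi> * s \<xi>) * V \<xi> t $ 1 - of_real (\<mu> / v * \<xi>\<^sup>2) * V \<xi> t $ 2"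
    using arg_cong[OF eq, of "\<lambda>x. x $ 2"]
    by (simp add: A_tilde_def B_tilde_def matrix_vector_mult_def sum_2 s_def algebra_simps
      scaleR_conv_of_real[where 'a = complex] add_eq_0_iff2 eq_diff_eq)
  with comp[of 2] show "((\<lambda>t. V \<xi> t $ 2) has_vector_derivative
      \<i> * of_real (\<xi> * s \<xi>) * V \<xi> t $ 1 - of_real (\<mu> / v * \<xi>\<^sup>2) * V \<xi> t $ 2)
      (at t within {0..})" by simp
qed

text \<open>Both components are coupled through the same factor \<open>\<i> * (\<xi> * s)\<close>,
  so the coupling cancels in |a|^2 + |b|^2. The weight \<rho> = \<xi> / s (for nonzero s) turns the
  factor \<xi> s in the derivative of the cross term into \<xi>^2, so that \<xi>^2 factors out of
  the whole derivative, damping included.\<close>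

lemma perturbed_energy_derivative:
  fixes a b :: "real \<Rightarrow> complex" and m s \<rho> \<xi> \<delta> :: real
  assumes a: "(a has_vector_derivative \<i> * of_real (\<xi> * s) * b t) (at t within S)"
    and b: "(b has_vector_derivative \<i> * of_real (\<xi> * s) * a t - of_real (m * \<xi>\<^sup>2) * b t)
      (at t within S)"
    and \<rho>: "\<rho> * s = \<xi>"
  shows "((\<lambda>t. (cmod (a t))\<^sup>2 + (cmod (b t))\<^sup>2 - 2 * \<delta> * \<rho> * Im (cnj (a t) * b t))
    has_real_derivative - \<xi>\<^sup>2 * (2 * m * (cmod (b t))\<^sup>2
      + 2 * \<delta> * ((cmod (a t))\<^sup>2 - (cmod (b t))\<^sup>2) - 2 * \<delta> * m * \<rho> * Im (cnj (a t) * b t)))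
    (at t within S)"
proof -
  note parts = bounded_linear.has_vector_derivative[OF bounded_linear_Re]
    bounded_linear.has_vector_derivative[OF bounded_linear_Im]
  note d = parts[OF a] parts[OF b]
  note d' = d[folded has_real_derivative_iff_has_vector_derivative]
  have Im_eq: "Im (cnj x * y) = Re x * Im y - Im x * Re y" for x y
    by simp
  show ?thesis
    \<comment> \<open>In real and imaginary parts, and with \<xi> replaced by \<rho> s, the claim
      becomes a polynomial identity.\<close>
    unfolding cmod_power2 \<rho>[symmetric] Im_eq
    by (rule d' derivative_eq_intros refl)+
      (simp add: \<rho>[symmetric] algebra_simps power2_eq_square)
qed

lemma abs_Im_cnj_mult_le: "2 * \<bar>Im (cnj a * b)\<bar> \<le> (cmod a)\<^sup>2 + (cmod b)\<^sup>2"
proof -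
  have "\<bar>Im (cnj a * b)\<bar> \<le> cmod a * cmod b"
    using abs_Im_le_cmod[of "cnj a * b"] by (simp add: norm_mult)
  then show ?thesis
    using sum_squares_bound[of "cmod a" "cmod b"] by linarith
qed

text \<open>This makes the perturbed energy equivalent to |a|^2 + |b|^2: it lies between 1/2 and 3/2
  times that quantity.\<close>

lemma perturbation_bound:
  assumes "\<delta> \<ge> 0" and "\<delta> * \<bar>\<rho>\<bar> \<le> 1 / 2"
  shows "\<bar>2 * \<delta> * \<rho> * Im (cnj a * b)\<bar> \<le> ((cmod a)\<^sup>2 + (cmod b)\<^sup>2) / 2"
proof -
  have "\<bar>2 * \<delta> * \<rho> * Im (cnj a * b)\<bar> = (\<delta> * \<bar>\<rho>\<bar>) * (2 * \<bar>Im (cnj a * b)\<bar>)"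
    using assms by (simp add: abs_mult)
  also have "\<dots> \<le> (1 / 2) * ((cmod a)\<^sup>2 + (cmod b)\<^sup>2)"
    using assms by (intro mult_mono abs_Im_cnj_mult_le) auto
  finally show ?thesis by simp
qed

text \<open>The cross term costs at most \<delta> |a|^2 + \<delta> m^2 L |b|^2. Of 2 \<delta> |a|^2
  this leaves \<delta> |a|^2, and the coefficient 2 m - 2 \<delta> - \<delta> m^2 L that remains for
  |b|^2 is at least \<delta> exactly when the smallness condition on \<delta> holds.\<close>

lemma dissipation_lower_bound:
  fixes m \<delta> \<rho> L :: real
  assumes "\<delta> \<ge> 0" and \<rho>: "\<rho>\<^sup>2 \<le> L" and \<delta>: "\<delta> * (3 + m\<^sup>2 * L) \<le> 2 * m"
  shows "\<delta> * ((cmod a)\<^sup>2 + (cmod b)\<^sup>2) \<le> 2 * m * (cmod b)\<^sup>2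
      + 2 * \<delta> * ((cmod a)\<^sup>2 - (cmod b)\<^sup>2) - 2 * \<delta> * m * \<rho> * Im (cnj a * b)"
proof -
  \<comment> \<open>Moving the whole weight m \<rho> onto b before Young's inequality keeps the
    coefficient of |a|^2 equal to 1.\<close>
  have "m * \<rho> * Im (cnj a * b) = Im (cnj a * (of_real (m * \<rho>) * b))"
    by (simp add: algebra_simps)
  then have "2 * (m * \<rho> * Im (cnj a * b)) \<le> 2 * \<bar>Im (cnj a * (of_real (m * \<rho>) * b))\<bar>"
    by linarith
  also have "\<dots> \<le> (cmod a)\<^sup>2 + (cmod (of_real (m * \<rho>) * b))\<^sup>2"
    by (rule abs_Im_cnj_mult_le)
  also have "\<dots> = (cmod a)\<^sup>2 + m\<^sup>2 * \<rho>\<^sup>2 * (cmod b)\<^sup>2"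
    by (simp add: norm_mult power_mult_distrib)
  also have "m\<^sup>2 * \<rho>\<^sup>2 * (cmod b)\<^sup>2 \<le> m\<^sup>2 * L * (cmod b)\<^sup>2"
    using \<rho> by (intro mult_right_mono mult_left_mono) auto
  finally have "\<delta> * (2 * (m * \<rho> * Im (cnj a * b))) \<le> \<delta> * ((cmod a)\<^sup>2 + m\<^sup>2 * L * (cmod b)\<^sup>2)"
    using \<open>\<delta> \<ge> 0\<close> by (intro mult_left_mono) auto
  moreover have "\<delta> * (3 + m\<^sup>2 * L) * (cmod b)\<^sup>2 \<le> 2 * m * (cmod b)\<^sup>2"
    using \<delta> by (intro mult_right_mono) auto
  ultimately show ?thesis by (simp add: algebra_simps)
qed

theorem lemma5p2:
  fixes v q \<kappa> \<mu> :: real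
  assumes "v > 0" and "q > 0" and "\<kappa> > 0" and "\<mu> > 0"
  shows "\<exists>C k :: real. C > 0 \<and> k > 0 \<and>
    (\<forall>V :: real \<Rightarrow> real \<Rightarrow> complex^2. is_solution v q \<kappa> \<mu> V \<longrightarrow>
      (\<forall>\<xi>. \<forall>t\<ge>0.
        norm (V \<xi> t) \<le> C * norm (V \<xi> 0) * exp (- (k * \<xi>\<^sup>2 * t / (1 + \<xi>\<^sup>2)))))"
proof -
  define m where "m = \<mu> / v"
  \<comment> \<open>The first bound serves \<open>dissipation_lower_bound\<close> with L = 1 /
    \<kappa>, the second gives \<delta> |\<rho>| \<le> 1/2. Neither involves \<xi>.\<close>
  define \<delta> where "\<delta> = min (2 * m / (3 + m\<^sup>2 * (1 / \<kappa>))) (sqrt \<kappa> / 2)"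
  have "m > 0" using assms by (simp add: m_def)
  have pos: "3 + m\<^sup>2 * (1 / \<kappa>) > 0"
    using \<open>\<kappa> > 0\<close> by (intro add_pos_nonneg) auto
  have "\<delta> > 0" using pos \<open>m > 0\<close> \<open>\<kappa> > 0\<close> by (simp add: \<delta>_def)
  have "\<delta> \<le> 2 * m / (3 + m\<^sup>2 * (1 / \<kappa>))" by (simp add: \<delta>_def)
  with pos have \<delta>1: "\<delta> * (3 + m\<^sup>2 * (1 / \<kappa>)) \<le> 2 * m" by (simp only: pos_le_divide_eq)
  have \<delta>2: "\<delta> \<le> sqrt \<kappa> / 2" by (simp add: \<delta>_def)
  \<comment> \<open>The squared norm satisfies the estimate with constant 3, the ratio of the
    equivalence constants 3/2 and 1/2, and rate (2/3) \<delta> \<xi>^2; the square root halves the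
    rate.\<close>
  have bound: "norm (V \<xi> t) \<le> sqrt 3 * norm (V \<xi> 0) * exp (- (\<delta> / 3 * \<xi>\<^sup>2 * t / (1 + \<xi>\<^sup>2)))"
    if sol: "is_solution v q \<kappa> \<mu> V" and "t \<ge> 0" for V :: "real \<Rightarrow> real \<Rightarrow> complex^2" and \<xi> t
  proof -
    define s where "s = sqrt (beta q \<kappa> \<xi>)"
    define \<rho> where "\<rho> = \<xi> / s"
    have \<beta>: "beta q \<kappa> \<xi> > 0"
      using assms by (simp add: beta_def add_pos_nonneg)
    have s: "\<rho> * s = \<xi>" using \<beta> by (simp add: \<rho>_def s_def)
    \<comment> \<open>Here the capillarity term enters: \<rho>^2 = \<xi>^2 / (q + \<xi>^2 \<kappa>)
      stays bounded as \<xi> grows.\<close>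
    have \<rho>2: "\<rho>\<^sup>2 \<le> 1 / \<kappa>"
      using \<beta> assms by (simp add: \<rho>_def s_def power_divide field_simps) (simp add: beta_def)
    have "\<bar>\<rho>\<bar> \<le> 1 / sqrt \<kappa>"
      using real_sqrt_le_mono[OF \<rho>2] by (simp add: real_sqrt_divide)
    then have "\<delta> * \<bar>\<rho>\<bar> \<le> sqrt \<kappa> / 2 * (1 / sqrt \<kappa>)"
      using \<delta>2 \<open>\<delta> > 0\<close> \<open>\<kappa> > 0\<close> by (intro mult_mono) auto
    then have \<delta>\<rho>: "\<delta> * \<bar>\<rho>\<bar> \<le> 1 / 2" using \<open>\<kappa> > 0\<close> by simp
    define a b where "a = (\<lambda>t. V \<xi> t $ 1)" and "b = (\<lambda>t. V \<xi> t $ 2)"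
    define P where "P = (\<lambda>t. 2 * \<delta> * \<rho> * Im (cnj (a t) * b t))"
    define N where "N = (\<lambda>t. (cmod (a t))\<^sup>2 + (cmod (b t))\<^sup>2)"
    define E' where "E' = (\<lambda>t. - \<xi>\<^sup>2 * (2 * m * (cmod (b t))\<^sup>2
      + 2 * \<delta> * ((cmod (a t))\<^sup>2 - (cmod (b t))\<^sup>2) - 2 * \<delta> * m * \<rho> * Im (cnj (a t) * b t)))"
    have N: "N x = (norm (V \<xi> x))\<^sup>2" for x
      by (simp add: N_def a_def b_def norm_vec_def L2_set_def sum_2)
    have P: "\<bar>P x\<bar> \<le> N x / 2" for x
      unfolding P_def N_def using \<open>\<delta> > 0\<close> \<delta>\<rho> by (intro perturbation_bound) auto
    have "N t - P t \<le> (N 0 - P 0) * exp (- (2 / 3 * \<delta> * \<xi>\<^sup>2) * t)"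
    proof (rule exponential_decay_of_differential_inequality[where E' = E'])
      fix x :: real assume "x \<ge> 0"
      show "((\<lambda>t. N t - P t) has_real_derivative E' x) (at x within {0..})"
        unfolding N_def P_def E'_def
        using is_solution_components[OF sol \<open>x \<ge> 0\<close>, of \<xi>]
        by (intro perturbed_energy_derivative[OF _ _ s]) (simp_all add: a_def b_def m_def s_def)
      have "\<delta> * N x \<le> 2 * m * (cmod (b x))\<^sup>2 + 2 * \<delta> * ((cmod (a x))\<^sup>2 - (cmod (b x))\<^sup>2)
          - 2 * \<delta> * m * \<rho> * Im (cnj (a x) * b x)"
        unfolding N_def using \<open>\<delta> > 0\<close> \<rho>2 \<delta>1 by (intro dissipation_lower_bound) auto
      \<comment> \<open>The factor 2/3 converts dissipation of \<open>N\<close> into decay of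
        \<open>N - P\<close>, since \<open>N - P\<close> is at most 3/2 of \<open>N\<close>.\<close>
      moreover have "\<delta> * (2 / 3 * (N x - P x)) \<le> \<delta> * N x"
        using P[of x] \<open>\<delta> > 0\<close> by (intro mult_left_mono) auto
      ultimately have "\<xi>\<^sup>2 * (\<delta> * (2 / 3 * (N x - P x))) \<le> - E' x"
        unfolding E'_def by (simp only: mult_minus_left minus_minus) (intro mult_left_mono, auto)
      then show "E' x \<le> - (2 / 3 * \<delta> * \<xi>\<^sup>2) * (N x - P x)"
        by (simp add: field_simps)
    qed fact
    also have "\<dots> \<le> 3 / 2 * N 0 * exp (- (2 / 3 * \<delta> * \<xi>\<^sup>2) * t)"
      using P[of 0] by (intro mult_right_mono) auto
    finally have "N t \<le> 3 * N 0 * exp (- (2 / 3 * \<delta> * \<xi>\<^sup>2) * t)"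
      using P[of t] by linarith
    also have "\<dots> = (sqrt 3 * norm (V \<xi> 0) * exp (- (\<delta> / 3 * \<xi>\<^sup>2 * t)))\<^sup>2"
      by (simp add: N power_mult_distrib exp_double[symmetric] algebra_simps)
    finally have "norm (V \<xi> t) \<le> sqrt 3 * norm (V \<xi> 0) * exp (- (\<delta> / 3 * \<xi>\<^sup>2 * t))"
      unfolding N by (rule power2_le_imp_le) simp
    also have "\<dots> \<le> sqrt 3 * norm (V \<xi> 0) * exp (- (\<delta> / 3 * \<xi>\<^sup>2 * t / (1 + \<xi>\<^sup>2)))"
    proof -
      have "\<delta> / 3 * \<xi>\<^sup>2 * t / (1 + \<xi>\<^sup>2) \<le> \<delta> / 3 * \<xi>\<^sup>2 * t / 1"
        using \<open>\<delta> > 0\<close> \<open>t \<ge> 0\<close> by (intro divide_left_mono) (auto simp: add_pos_nonneg)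
      then show ?thesis by (intro mult_left_mono) auto
    qed
    finally show ?thesis .
  qed
  show ?thesis
    using \<open>\<delta> > 0\<close> bound by (intro exI[of _ "sqrt 3"] exI[of _ "\<delta> / 3"]) auto
qed

end
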